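(* Let $d\geq 2$ and let $A=(a_0,a_1,\ldots,a_{d-1})$ be a tuple of $d$ points in general position in the plane $\mathbb{R}^2$. Then the (extended) Hakopian operator $\mathcal H[A]$ is continuously defined on $C(cv(A))$ by the formula $$\mathcal {H}[A;f]=\sum_{0\leq s<t\leq d-1} Q_{st} \int_{[a_s,a_t]}f,\qquad f\in C(cv(A)),$$ where $$Q_{st}(x)=\frac{h'_{st}\big( \langle (a_s-a_t)^{\bot},x\rangle\big)}{h'_{st}\big( \langle (a_s-a_t)^{\bot},a_s\rangle\big)},\qquad x\in\mathbb{R}^2,$$ and $h_{st}(w)=\prod_{m=0,m\ne s}^{d-1}\big (w-\langle (a_s-a_t)^{\bot},a_m\rangle \big)$ for $w\in\mathbb{R}$.
   Context: $cv(A)$ is the convex hull of $\{a_0,\dots,a_{d-1}\}$ and $C(cv(A))$ is the space of continuous functions on it with the sup norm. Points are in general position in $\mathbb{R}^2$ if every three of them (with distinct indices) form an affine basis of $\mathbb{R}^2$, i.e. no three are collinear. For $y=(y^1,y^2)\in\mathbb{R}^2$, $y^{\bot}=(-y^2,y^1)$; $\langle\cdot,\cdot\rangle$ is the Euclidean scalar product; $\int_{[a,b]}g:=\int_0^1 g(a+w(b-a))\,dw$. Hakopian interpolation in $\mathbb{R}^2$: for $A$ in general position and $f\in C(cv(A))$, the (extended) Hakopian interpolation polynomial $\mathcal H[A;f]$ is the unique real polynomial $P$ in two variables of degree at most $d-2$ such that $\int_{[a_u,a_v]}(f-P)=0$ for all $0\le u<v\le d-1$. *)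

theory Defs
  imports "HOL-Analysis.Analysis"
begin

text \<open>A tuple of \<open>d\<close> points is a function \<open>a :: nat \<Rightarrow> real^2\<close>, of which only the values at
  \<open>0, \<dots>, d - 1\<close> matter.\<close>

text \<open>If two of the three points coincide, the affine hull is not the whole plane, so the points
  of an affine basis are automatically distinct. For \<open>d = 2\<close> the condition is vacuous.\<close>

definition general_position :: "nat \<Rightarrow> (nat \<Rightarrow> real^2) \<Rightarrow> bool" where
  "general_position d a \<longleftrightarrow>
     (\<forall>i<d. \<forall>j<d. \<forall>k<d. i \<noteq> j \<and> j \<noteq> k \<and> i \<noteq> k \<longrightarrow>
        \<not> affine_dependent {a i, a j, a k} \<and> affine hull {a i, a j, a k} = UNIV)"

definition cv :: "nat \<Rightarrow> (nat \<Rightarrow> real^2) \<Rightarrow> (real^2) set" where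
  "cv d a = convex hull (a ` {..<d})"

text \<open>The space \<open>C(S)\<close> with the sup metric. Its elements are functions on the whole plane that
  are \<open>undefined\<close> outside \<open>S\<close>. The polynomials of degree at most \<open>n\<close> carry the only Hausdorff
  vector space topology there is on a finite-dimensional space, that of uniform convergence on
  compact sets; a map into them is continuous iff its composition with the restriction to \<open>C(K)\<close>
  is, for every compact \<open>K\<close>.\<close>

abbreviation C_space :: "(real^2) set \<Rightarrow> (real^2 \<Rightarrow> real) metric" where
  "C_space S \<equiv> cfunspace (top_of_set S) euclidean_metric"

definition perp :: "real^2 \<Rightarrow> real^2" where
  "perp y = vector [- (y $ 2), y $ 1]"

definition segment_integral :: "real^2 \<Rightarrow> real^2 \<Rightarrow> (real^2 \<Rightarrow> real) \<Rightarrow> real" where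
  "segment_integral p q g = integral {0..1} (\<lambda>w. g (p + w *\<^sub>R (q - p)))"

text \<open>Real polynomials in two variables are identified with the functions they induce on the
  plane; \<open>n\<close> bounds the total degree.\<close>

definition poly2_degree_le :: "nat \<Rightarrow> (real^2 \<Rightarrow> real) \<Rightarrow> bool" where
  "poly2_degree_le n P \<longleftrightarrow>
     (\<exists>c :: nat \<Rightarrow> nat \<Rightarrow> real. \<forall>x. P x = (\<Sum>i\<le>n. \<Sum>j\<le>n - i. c i j * (x $ 1) ^ i * (x $ 2) ^ j))"

definition hakopian_interpolant ::
    "nat \<Rightarrow> (nat \<Rightarrow> real^2) \<Rightarrow> (real^2 \<Rightarrow> real) \<Rightarrow> (real^2 \<Rightarrow> real) \<Rightarrow> bool" where
  "hakopian_interpolant d a f P \<longleftrightarrow>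
     poly2_degree_le (d - 2) P \<and>
     (\<forall>u v. u < v \<and> v < d \<longrightarrow> segment_integral (a u) (a v) (\<lambda>x. f x - P x) = 0)"

definition hakopian :: "nat \<Rightarrow> (nat \<Rightarrow> real^2) \<Rightarrow> (real^2 \<Rightarrow> real) \<Rightarrow> real^2 \<Rightarrow> real" where
  "hakopian d a f = (THE P. hakopian_interpolant d a f P)"

definition h_fun :: "nat \<Rightarrow> (nat \<Rightarrow> real^2) \<Rightarrow> nat \<Rightarrow> nat \<Rightarrow> real \<Rightarrow> real" where
  "h_fun d a s t w = (\<Prod>m\<in>{..<d} - {s}. w - perp (a s - a t) \<bullet> a m)"

definition Q_fun :: "nat \<Rightarrow> (nat \<Rightarrow> real^2) \<Rightarrow> nat \<Rightarrow> nat \<Rightarrow> real^2 \<Rightarrow> real" where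
  "Q_fun d a s t x =
     deriv (h_fun d a s t) (perp (a s - a t) \<bullet> x) / deriv (h_fun d a s t) (perp (a s - a t) \<bullet> a s)"

end

theory Submission
  imports Defs "HOL-Library.Function_Algebras"
begin

text \<open>
  Write \<open>n = perp (a s - a t)\<close>. On the segment from \<open>a u\<close> to \<open>a v\<close> the linear form \<open>x \<mapsto> n \<bullet> x\<close>
  runs affinely from \<open>n \<bullet> a u\<close> to \<open>n \<bullet> a v\<close>. The polynomial \<open>h = h_fun d a s t\<close> vanishes at
  \<open>n \<bullet> a m\<close> for every \<open>m < d\<close>, also for \<open>m = s\<close>, since \<open>n \<bullet> a s = n \<bullet> a t\<close>. Hence, if
  \<open>n \<bullet> a u \<noteq> n \<bullet> a v\<close>, the fundamental theorem of calculus makes the integral of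
  \<open>x \<mapsto> h' (n \<bullet> x)\<close> over that segment zero. If \<open>n \<bullet> a u = n \<bullet> a v\<close>, the integrand is constant on the
  segment; either \<open>{u, v} = {s, t}\<close>, or, as no three points are collinear, \<open>u\<close> and \<open>v\<close> both lie
  outside \<open>{s, t}\<close>, and then \<open>n \<bullet> a u\<close> is a double root of \<open>h\<close> and the constant is zero. So the
  polynomials \<open>Q_fun d a s t\<close> are biorthogonal to the segment integrals
  (\<open>segment_integral_Q_fun\<close>), and the formula yields an interpolant of degree at most \<open>d - 2\<close>.

  Biorthogonality makes the \<open>Q_fun d a s t\<close> linearly independent. They are indexed by the pairs
  \<open>s < t < d\<close>, and these are as many as the monomials of degree at most \<open>d - 2\<close>; therefore
  they form a basis, and a polynomial of degree at most \<open>d - 2\<close> whose segment integrals vanish is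
  zero (\<open>poly2_zero_if_segment_integrals_zero\<close>). This is uniqueness. Finally, each segment
  integral is bounded by the supremum norm and each \<open>Q_fun d a s t\<close> is bounded on compact sets, so
  the formula defines a Lipschitz map from \<open>C(cv(A))\<close> to \<open>C(K)\<close> (\<open>continuous_map_hakopian\<close>).
\<close>

section \<open>Spanning by an independent family of maximal size\<close>

text \<open>Independence is stated for the family \<open>q\<close>, not for the set \<open>q ` I\<close>, because this is what
  evaluating biorthogonal functionals yields; it includes the injectivity of \<open>q\<close> on \<open>I\<close>.\<close>

lemma (in vector_space) independent_family_spans:
  assumes fin: "finite I" "finite B" and card: "card B \<le> card I"
    and q: "\<And>i. i \<in> I \<Longrightarrow> q i \<in> span B"
    and indep: "\<And>c i. (\<Sum>i\<in>I. scale (c i) (q i)) = 0 \<Longrightarrow> i \<in> I \<Longrightarrow> c i = 0"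
    and v: "v \<in> span B"
  shows "\<exists>c. v = (\<Sum>i\<in>I. scale (c i) (q i))"
proof -
  have inj: "inj_on q I"
  proof (rule inj_onI, rule ccontr)
    fix i j assume ij: "i \<in> I" "j \<in> I" "q i = q j" "i \<noteq> j"
    define c where "c k = (if k = i then 1 else if k = j then - 1 else 0 :: 'a)" for k
    have "(\<Sum>k\<in>I. scale (c k) (q k)) = (\<Sum>k\<in>{i, j}. scale (c k) (q k))"
      using ij fin by (intro sum.mono_neutral_right) (auto simp: c_def)
    also have "\<dots> = 0" using ij by (simp add: c_def)
    finally have "c i = 0" using indep ij by blast
    then show False by (simp add: c_def)
  qed
  have ind: "independent (q ` I)"
  proof (rule independent_if_scalars_zero)
    fix f x assume "(\<Sum>x\<in>q ` I. scale (f x) x) = 0" "x \<in> q ` I"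
    then show "f x = 0"
      using indep[of "f \<circ> q"] by (auto simp: sum.reindex[OF inj])
  qed (use fin in simp)
  have "v \<in> span (q ` I)"
  proof (rule ccontr)
    assume n: "v \<notin> span (q ` I)"
    then have "independent (insert v (q ` I))" using ind by (rule independent_insertI)
    moreover have "insert v (q ` I) \<subseteq> span B" using v q by auto
    ultimately have "card (insert v (q ` I)) \<le> card B"
      using independent_span_bound fin(2) by blast
    moreover have "v \<notin> q ` I" using n span_base by blast
    ultimately show False using fin card by (simp add: card_image[OF inj])
  qed
  then obtain u where "v = (\<Sum>w\<in>q ` I. scale (u w) w)"
    using fin by (auto simp: span_finite)
  then have "v = (\<Sum>i\<in>I. scale (u (q i)) (q i))" by (simp add: sum.reindex[OF inj])
  then show ?thesis by (rule exI[where x = "\<lambda>i. u (q i)"])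
qed

section \<open>Bivariate polynomial functions\<close>

text \<open>Real functions with the pointwise operations form a vector space, in which \<open>poly2_degree_le n\<close>
  is the span of the monomials of degree at most \<open>n\<close>.\<close>

global_interpretation fun_space:
  vector_space "(\<lambda>r f x. r * f x) :: real \<Rightarrow> ('a \<Rightarrow> real) \<Rightarrow> 'a \<Rightarrow> real"
  by standard (auto simp: fun_eq_iff algebra_simps)

text \<open>The monomial function \<open>x\<^sub>1\<^sup>i x\<^sub>2\<^sup>j\<close>; its exponents are given as a pair.\<close>

definition monom2 :: "nat \<times> nat \<Rightarrow> real^2 \<Rightarrow> real" where
  "monom2 = (\<lambda>(i, j) x. (x $ 1) ^ i * (x $ 2) ^ j)"

text \<open>The monomial functions of total degree at most \<open>n\<close>.\<close>

definition monoms2 :: "nat \<Rightarrow> (real^2 \<Rightarrow> real) set" where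
  "monoms2 n = monom2 ` (SIGMA i:{..n}. {..n - i})"

lemma finite_monoms2: "finite (monoms2 n)"
  by (simp add: monoms2_def)

lemma monom2_in_monoms2: "i + j \<le> n \<Longrightarrow> monom2 (i, j) \<in> monoms2 n"
  by (auto simp: monoms2_def)

lemma sum_fun_apply: "(\<Sum>i\<in>I. f i) x = (\<Sum>i\<in>I. f i x :: real)"
  by (induction I rule: infinite_finite_induct) auto

lemma poly2_degree_le_iff_span: "poly2_degree_le n P \<longleftrightarrow> P \<in> fun_space.span (monoms2 n)"
proof
  assume "poly2_degree_le n P"
  then obtain c where c: "\<And>x. P x = (\<Sum>i\<le>n. \<Sum>j\<le>n - i. c i j * (x $ 1) ^ i * (x $ 2) ^ j)"
    unfolding poly2_degree_le_def by blast
  have "P = (\<Sum>i\<le>n. \<Sum>j\<le>n - i. (\<lambda>x. c i j * monom2 (i, j) x))"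
    by (rule ext) (simp add: c sum_fun_apply monom2_def mult.assoc)
  also have "\<dots> \<in> fun_space.span (monoms2 n)"
    by (intro fun_space.span_sum fun_space.span_scale fun_space.span_base monom2_in_monoms2) auto
  finally show "P \<in> fun_space.span (monoms2 n)" .
next
  assume "P \<in> fun_space.span (monoms2 n)"
  moreover have "inj_on monom2 A" for A :: "(nat \<times> nat) set"
  proof (rule inj_onI, clarify)
    fix i j k l assume eq: "monom2 (i, j) = monom2 (k, l)"
    \<comment> \<open>The exponents are read off from the values \<open>2 ^ i\<close> at \<open>(2, 1)\<close> and \<open>2 ^ j\<close> at \<open>(1, 2)\<close>.\<close>
    have "monom2 (i, j) (vector [2, 1]) = monom2 (k, l) (vector [2, 1])"
      "monom2 (i, j) (vector [1, 2]) = monom2 (k, l) (vector [1, 2])" using eq by auto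
    then show "i = k \<and> j = l" by (simp add: monom2_def)
  qed
  ultimately obtain u where "P = (\<Sum>p\<in>(SIGMA i:{..n}. {..n - i}). (\<lambda>x. u (monom2 p) * monom2 p x))"
    by (auto simp: fun_space.span_finite finite_monoms2 monoms2_def sum.reindex)
  then have "P x = (\<Sum>i\<le>n. \<Sum>j\<le>n - i. u (monom2 (i, j)) * (x $ 1) ^ i * (x $ 2) ^ j)" for x
    by (simp add: sum_fun_apply sum.Sigma split_def monom2_def mult.assoc)
  then show "poly2_degree_le n P"
    unfolding poly2_degree_le_def by (intro exI[of _ "\<lambda>i j. u (monom2 (i, j))"]) blast
qed

lemma poly2_degree_le_const: "poly2_degree_le n (\<lambda>x. c)"
proof -
  have "(\<lambda>x. c * monom2 (0, 0) x) \<in> fun_space.span (monoms2 n)"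
    by (intro fun_space.span_scale fun_space.span_base monom2_in_monoms2) auto
  then show ?thesis by (simp add: poly2_degree_le_iff_span monom2_def)
qed

lemma poly2_degree_le_cmult: "poly2_degree_le n P \<Longrightarrow> poly2_degree_le n (\<lambda>x. c * P x)"
  unfolding poly2_degree_le_iff_span by (rule fun_space.span_scale)

lemma poly2_degree_le_diff:
  assumes "poly2_degree_le n P" "poly2_degree_le n Q"
  shows "poly2_degree_le n (\<lambda>x. P x - Q x)"
  using fun_space.span_diff[OF assms[unfolded poly2_degree_le_iff_span]]
  by (simp add: poly2_degree_le_iff_span fun_diff_def)

lemma poly2_degree_le_sum:
  assumes "\<And>i. i \<in> I \<Longrightarrow> poly2_degree_le n (f i)"
  shows "poly2_degree_le n (\<lambda>x. \<Sum>i\<in>I. f i x)"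
proof -
  have "(\<lambda>x. \<Sum>i\<in>I. f i x) = (\<Sum>i\<in>I. f i)" by (rule ext) (simp add: sum_fun_apply)
  then show ?thesis
    using assms by (auto simp: poly2_degree_le_iff_span intro: fun_space.span_sum)
qed

lemma poly2_degree_le_mult_affine:
  assumes "poly2_degree_le n P"
  shows "poly2_degree_le (Suc n) (\<lambda>x. (v \<bullet> x - c) * P x)"
  using assms[unfolded poly2_degree_le_iff_span]
proof (induction rule: fun_space.span_induct_alt)
  case base
  then show ?case using poly2_degree_le_const[of "Suc n" 0] by simp
next
  case (step r m Q)
  from step(1) obtain i j where m: "m = monom2 (i, j)" and ij: "i \<le> n" "j \<le> n - i"
    by (auto simp: monoms2_def)
  define R where "R = (\<lambda>x. r * v $ 1 * monom2 (Suc i, j) x) +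
    (\<lambda>x. r * v $ 2 * monom2 (i, Suc j) x) + (\<lambda>x. - r * c * monom2 (i, j) x)"
  have "R \<in> fun_space.span (monoms2 (Suc n))" unfolding R_def
    using ij by (intro fun_space.span_add fun_space.span_scale fun_space.span_base
        monom2_in_monoms2) auto
  then have "R + (\<lambda>x. (v \<bullet> x - c) * Q x) \<in> fun_space.span (monoms2 (Suc n))"
    using step(2) by (auto simp: poly2_degree_le_iff_span intro: fun_space.span_add)
  also have "R + (\<lambda>x. (v \<bullet> x - c) * Q x)
      = (\<lambda>x. (v \<bullet> x - c) * ((\<lambda>x. r * m x) + Q) x)"
    by (rule ext) (simp add: R_def m monom2_def inner_vec_def sum_2 algebra_simps)
  finally show ?case by (simp add: poly2_degree_le_iff_span)
qed

lemma poly2_degree_le_prod_affine: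
  assumes "finite A"
  shows "poly2_degree_le (card A) (\<lambda>x. \<Prod>m\<in>A. v \<bullet> x - c m)"
  using assms
proof (induction A)
  case empty
  then show ?case by (simp add: poly2_degree_le_const)
next
  case (insert k A)
  then show ?case using poly2_degree_le_mult_affine[OF insert(3)] by simp
qed

lemma continuous_on_poly2:
  assumes "poly2_degree_le n P"
  shows "continuous_on S P"
proof -
  obtain c where "P = (\<lambda>x. \<Sum>i\<le>n. \<Sum>j\<le>n - i. c i j * (x $ 1) ^ i * (x $ 2) ^ j)"
    using assms unfolding poly2_degree_le_def by blast
  then show ?thesis by (auto intro!: continuous_intros)
qed

section \<open>Integrals over segments\<close>

lemma segment_point_in_convex:
  fixes p q :: "'a::real_vector" and w :: real
  assumes "convex S" "p \<in> S" "q \<in> S" "w \<in> {0..1}"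
  shows "p + w *\<^sub>R (q - p) \<in> S"
proof -
  have "(1 - w) *\<^sub>R p + w *\<^sub>R q \<in> S" using assms by (intro convexD) auto
  then show ?thesis by (simp add: algebra_simps)
qed

lemma continuous_on_segment_path:
  fixes p q :: "'a::real_normed_vector"
  assumes "continuous_on S f" "convex S" "p \<in> S" "q \<in> S"
  shows "continuous_on {0..1::real} (\<lambda>w. f (p + w *\<^sub>R (q - p)))"
proof (rule continuous_on_compose2[OF assms(1)])
  show "(\<lambda>w. p + w *\<^sub>R (q - p)) ` {0..1} \<subseteq> S"
    using segment_point_in_convex assms(2-4) by blast
qed (auto intro!: continuous_intros)

lemma segment_integral_diff:
  assumes "continuous_on S f" "continuous_on S g" "convex S" "p \<in> S" "q \<in> S"
  shows "segment_integral p q (\<lambda>x. f x - g x) = segment_integral p q f - segment_integral p q g"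
  unfolding segment_integral_def
  by (intro integral_diff integrable_continuous_interval continuous_on_segment_path) (use assms in auto)

lemma segment_integral_sum_cmult:
  assumes "finite I" "\<And>i. i \<in> I \<Longrightarrow> continuous_on UNIV (f i)"
  shows "segment_integral p q (\<lambda>x. \<Sum>i\<in>I. c i * f i x) = (\<Sum>i\<in>I. c i * segment_integral p q (f i))"
  unfolding segment_integral_def
  by (subst integral_sum)
    (auto intro!: assms integrable_continuous_interval continuous_intros
      continuous_on_segment_path[where S = UNIV])

lemma abs_segment_integral_le:
  assumes "continuous_on S f" "convex S" "p \<in> S" "q \<in> S" "\<And>x. x \<in> S \<Longrightarrow> \<bar>f x\<bar> \<le> B"
  shows "\<bar>segment_integral p q f\<bar> \<le> B"
proof -
  have "norm (integral {0..1} (\<lambda>w. f (p + w *\<^sub>R (q - p)))) \<le> B * (1 - 0)"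
    using assms by (intro integral_bound continuous_on_segment_path[of S])
      (auto simp: segment_point_in_convex)
  then show ?thesis by (simp add: segment_integral_def)
qed

section \<open>The polynomials \<open>h\<^sub>s\<^sub>t\<close> and \<open>Q\<^sub>s\<^sub>t\<close>\<close>

lemma perp_inner: "perp y \<bullet> x = y $ 1 * x $ 2 - y $ 2 * x $ 1"
  by (simp add: perp_def inner_vec_def sum_2)

lemma perp_inner_endpoints: "perp (p - q) \<bullet> q = perp (p - q) \<bullet> p"
  by (simp add: perp_inner algebra_simps)

lemma perp_eq_0_iff: "perp y = 0 \<longleftrightarrow> y = 0"
  by (auto simp: perp_def vec_eq_iff forall_2)

text \<open>\<open>perp (p - q)\<close> is a normal vector of the line through \<open>p\<close> and \<open>q\<close>.\<close>

lemma general_position_not_collinear: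
  assumes "general_position d a" "i < d" "j < d" "k < d" "i \<noteq> j" "k \<noteq> i" "k \<noteq> j"
  shows "perp (a i - a j) \<bullet> a k \<noteq> perp (a i - a j) \<bullet> a i"
proof
  define n where "n = perp (a i - a j)"
  have hull: "affine hull {a i, a j, a k} = UNIV"
    using assms unfolding general_position_def by blast
  assume eq: "perp (a i - a j) \<bullet> a k = perp (a i - a j) \<bullet> a i"
  have "affine hull {a i, a j, a k} \<subseteq> {x. n \<bullet> x = n \<bullet> a i}"
    using eq perp_inner_endpoints by (intro hull_minimal affine_hyperplane) (auto simp: n_def)
  then have all: "n \<bullet> x = n \<bullet> a i" for x using hull by auto
  \<comment> \<open>A linear form that is constant on the plane is zero; then \<open>a i\<close> and \<open>a j\<close> coincide and the
    three points span at most a line.\<close>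
  have "n = 0" using all[of 0] all[of n] by simp
  then have "a i = a j" by (simp add: n_def perp_eq_0_iff)
  have "aff_dim {a i, a j, a k} = 2"
    by (subst aff_dim_affine_hull[symmetric]) (simp add: hull)
  moreover have "aff_dim {a i, a j, a k} \<le> int (card {a i, a k}) - 1"
    using \<open>a i = a j\<close> aff_dim_le_card[of "{a i, a k}"] by simp
  moreover have "card {a i, a k} \<le> 2" by (simp add: card_insert_if)
  ultimately show False by simp
qed

lemma h_fun_has_derivative:
  fixes d a s t
  defines "A \<equiv> {..<d} - {s}" and "\<alpha> \<equiv> \<lambda>m. perp (a s - a t) \<bullet> a m"
  shows "(h_fun d a s t has_field_derivative (\<Sum>k\<in>A. \<Prod>m\<in>A - {k}. w - \<alpha> m)) (at w)"
proof -
  have "((\<lambda>u. \<Prod>m\<in>A. u - \<alpha> m) has_field_derivative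
      (\<Sum>k\<in>A. 1 * (\<Prod>m\<in>A - {k}. w - \<alpha> m))) (at w)"
    by (rule has_field_derivative_prod) (auto intro!: derivative_eq_intros)
  then show ?thesis by (simp add: h_fun_def[abs_def] A_def \<alpha>_def)
qed

lemmas deriv_h_fun = DERIV_imp_deriv[OF h_fun_has_derivative]

lemma deriv_h_fun_at_root:
  fixes d a s t
  defines "A \<equiv> {..<d} - {s}" and "\<alpha> \<equiv> \<lambda>m. perp (a s - a t) \<bullet> a m"
  assumes "k \<in> A"
  shows "deriv (h_fun d a s t) (\<alpha> k) = (\<Prod>m\<in>A - {k}. \<alpha> k - \<alpha> m)"
proof -
  have "(\<Sum>l\<in>A. \<Prod>m\<in>A - {l}. \<alpha> k - \<alpha> m) = (\<Sum>l\<in>{k}. \<Prod>m\<in>A - {l}. \<alpha> k - \<alpha> m)"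
    using assms by (intro sum.mono_neutral_right) auto
  then show ?thesis by (simp add: deriv_h_fun A_def \<alpha>_def)
qed

text \<open>\<open>perp (a s - a t) \<bullet> a s\<close> is the root with index \<open>t\<close>, and it is a simple root.\<close>

lemma deriv_h_fun_nonzero:
  assumes "general_position d a" "s < d" "t < d" "s \<noteq> t"
  shows "deriv (h_fun d a s t) (perp (a s - a t) \<bullet> a s) \<noteq> 0"
proof -
  have "deriv (h_fun d a s t) (perp (a s - a t) \<bullet> a s)
      = (\<Prod>m\<in>{..<d} - {s} - {t}. perp (a s - a t) \<bullet> a t - perp (a s - a t) \<bullet> a m)"
    using assms by (subst deriv_h_fun_at_root[symmetric]) (auto simp: perp_inner_endpoints)
  also have "\<dots> \<noteq> 0"
    using general_position_not_collinear[OF assms(1-3)] assms(4)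
    by (fastforce simp: perp_inner_endpoints)
  finally show ?thesis .
qed

lemma h_fun_root:
  assumes "s < d" "t < d" "s \<noteq> t" "m < d"
  shows "h_fun d a s t (perp (a s - a t) \<bullet> a m) = 0"
proof (cases "m = s")
  case True
  then show ?thesis
    using assms by (auto simp: h_fun_def perp_inner_endpoints intro!: bexI[of _ t])
next
  case False
  then show ?thesis using assms by (auto simp: h_fun_def)
qed

lemma poly2_degree_le_Q_fun:
  assumes "s < d"
  shows "poly2_degree_le (d - 2) (Q_fun d a s t)"
proof -
  define A where "A = {..<d} - {s}"
  define n where "n = perp (a s - a t)"
  have "poly2_degree_le (d - 2) (\<lambda>x. \<Prod>m\<in>A - {k}. n \<bullet> x - n \<bullet> a m)" if "k \<in> A" for k
    using poly2_degree_le_prod_affine[of "A - {k}" n "\<lambda>m. n \<bullet> a m"] that assms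
    by (simp add: A_def numeral_2_eq_2)
  then have "poly2_degree_le (d - 2)
     (\<lambda>x. inverse (deriv (h_fun d a s t) (n \<bullet> a s)) * (\<Sum>k\<in>A. \<Prod>m\<in>A - {k}. n \<bullet> x - n \<bullet> a m))"
    by (intro poly2_degree_le_cmult poly2_degree_le_sum)
  then show ?thesis
    by (simp add: Q_fun_def[abs_def] deriv_h_fun A_def n_def divide_inverse mult.commute)
qed

lemma segment_integral_Q_fun:
  assumes gp: "general_position d a" and st: "s < t" "t < d" and uv: "u < v" "v < d"
  shows "segment_integral (a u) (a v) (Q_fun d a s t) = (if s = u \<and> t = v then 1 else 0)"
proof -
  define n where "n = perp (a s - a t)"
  define h where "h = h_fun d a s t"
  define \<beta> where "\<beta> = n \<bullet> a v - n \<bullet> a u"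
  have D: "deriv h (n \<bullet> a s) \<noteq> 0"
    using deriv_h_fun_nonzero[OF gp, of s t] st by (simp add: h_def n_def)
  have h': "(h has_field_derivative deriv h w) (at w)" for w
    unfolding h_def using DERIV_deriv_iff_real_differentiable h_fun_has_derivative
    by (metis DERIV_imp_deriv)
  have h0: "h (n \<bullet> a m) = 0" if "m < d" for m
    using h_fun_root that st by (simp add: h_def n_def)
  have Q: "Q_fun d a s t (a u + w *\<^sub>R (a v - a u))
      = deriv h (n \<bullet> a u + w * \<beta>) / deriv h (n \<bullet> a s)" for w
    by (simp add: Q_fun_def h_def n_def \<beta>_def inner_add_right inner_diff_right)
  have ends: "n \<bullet> a t = n \<bullet> a s" by (simp add: n_def perp_inner_endpoints)
  show ?thesis
  proof (cases "\<beta> = 0")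
    case True
    have I: "segment_integral (a u) (a v) (Q_fun d a s t) = deriv h (n \<bullet> a u) / deriv h (n \<bullet> a s)"
      by (simp add: segment_integral_def Q True)
    show ?thesis
    proof (cases "s = u \<and> t = v")
      case True
      then show ?thesis using I D by simp
    next
      case False
      have nc: "n \<bullet> a m \<noteq> n \<bullet> a s" if "m < d" "m \<noteq> s" "m \<noteq> t" for m
        using general_position_not_collinear[OF gp, of s t m] st that by (simp add: n_def)
      have "u \<noteq> s" "u \<noteq> t" "v \<noteq> s" "v \<noteq> t"
        using nc[of u] nc[of v] \<open>\<beta> = 0\<close> ends False st uv by (auto simp: \<beta>_def)
      \<comment> \<open>\<open>u\<close> and \<open>v\<close> are distinct indices of factors of \<open>h\<close> that vanish at \<open>n \<bullet> a u\<close>.\<close>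
      then have "deriv h (n \<bullet> a u) = 0"
        unfolding h_def n_def using st uv \<open>\<beta> = 0\<close>
        by (subst deriv_h_fun_at_root) (auto simp: \<beta>_def n_def intro!: bexI[of _ v])
      then show ?thesis using I False by simp
    qed
  next
    case False
    have ne: "\<not> (s = u \<and> t = v)" using False ends by (auto simp: \<beta>_def)
    have "((\<lambda>w. deriv h (n \<bullet> a u + w * \<beta>) * \<beta>) has_integral
        h (n \<bullet> a u + 1 * \<beta>) - h (n \<bullet> a u + 0 * \<beta>)) {0..1}"
    proof (rule fundamental_theorem_of_calculus)
      fix w :: real
      have "((\<lambda>w. h (n \<bullet> a u + w * \<beta>)) has_field_derivative deriv h (n \<bullet> a u + w * \<beta>) * \<beta>)
          (at w within {0..1})"
        by (rule DERIV_chain2[OF h']) (auto intro!: derivative_eq_intros)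
      then show "((\<lambda>w. h (n \<bullet> a u + w * \<beta>)) has_vector_derivative deriv h (n \<bullet> a u + w * \<beta>) * \<beta>)
          (at w within {0..1})"
        by (simp add: has_real_derivative_iff_has_vector_derivative)
    qed simp
    \<comment> \<open>Both boundary values of \<open>h\<close> are zero.\<close>
    then have "((\<lambda>w. deriv h (n \<bullet> a u + w * \<beta>) * \<beta>) has_integral 0) {0..1}"
      using h0[of u] h0[of v] uv by (simp add: \<beta>_def)
    then have "((\<lambda>w. (deriv h (n \<bullet> a u + w * \<beta>) * \<beta>) * inverse (\<beta> * deriv h (n \<bullet> a s)))
        has_integral 0 * inverse (\<beta> * deriv h (n \<bullet> a s))) {0..1}"
      by (rule has_integral_mult_left)
    then have "((\<lambda>w. Q_fun d a s t (a u + w *\<^sub>R (a v - a u))) has_integral 0) {0..1}"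
      unfolding Q using False D by (simp add: field_simps)
    then show ?thesis using ne by (simp add: segment_integral_def integral_unique)
  qed
qed

section \<open>The interpolation problem\<close>

lemma poly2_zero_if_segment_integrals_zero:
  assumes d: "d \<ge> 2" and gp: "general_position d a"
    and P: "poly2_degree_le (d - 2) P"
    and zero: "\<And>u v. u < v \<Longrightarrow> v < d \<Longrightarrow> segment_integral (a u) (a v) P = 0"
  shows "P x = 0"
proof -
  define I where "I = (SIGMA t:{..<d}. {..<t})"
  define q where "q = (\<lambda>(t, s). Q_fun d a s t)"
  have finI: "finite I" by (simp add: I_def)
  have cont: "continuous_on UNIV (q i)" if "i \<in> I" for i
    using that continuous_on_poly2[OF poly2_degree_le_Q_fun] by (auto simp: I_def q_def)
  have coeff: "segment_integral (a u) (a v) (\<Sum>i\<in>I. (\<lambda>x. c i * q i x)) = c (v, u)"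
    if "(v, u) \<in> I" for u v c
  proof -
    have "segment_integral (a u) (a v) (\<Sum>i\<in>I. (\<lambda>x. c i * q i x))
        = segment_integral (a u) (a v) (\<lambda>x. \<Sum>i\<in>I. c i * q i x)"
      by (simp add: segment_integral_def sum_fun_apply)
    also have "\<dots> = (\<Sum>i\<in>I. c i * segment_integral (a u) (a v) (q i))"
      by (rule segment_integral_sum_cmult[OF finI cont])
    also have "\<dots> = (\<Sum>i\<in>I. if i = (v, u) then c i else 0)"
      using that by (intro sum.cong refl) (auto simp: I_def q_def segment_integral_Q_fun[OF gp] split: if_splits)
    also have "\<dots> = c (v, u)" using that finI by simp
    finally show ?thesis .
  qed
  \<comment> \<open>The pairs \<open>s < t < d\<close> correspond to the exponents \<open>(s, t - s - 1)\<close>, whose sum is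
    \<open>t - 1 \<le> d - 2\<close>.\<close>
  have "monoms2 (d - 2) \<subseteq> (\<lambda>(t, s). monom2 (s, t - s - 1)) ` I"
  proof
    fix m assume "m \<in> monoms2 (d - 2)"
    then obtain i j where "m = monom2 (i, j)" "i \<le> d - 2" "j \<le> d - 2 - i"
      by (auto simp: monoms2_def)
    then show "m \<in> (\<lambda>(t, s). monom2 (s, t - s - 1)) ` I"
      using d by (intro image_eqI[of _ _ "(i + j + 1, i)"]) (auto simp: I_def)
  qed
  then have card: "card (monoms2 (d - 2)) \<le> card I"
    using finI by (meson card_image_le card_mono finite_imageI order_trans)
  have "\<exists>c. P = (\<Sum>i\<in>I. (\<lambda>x. c i * q i x))"
  proof (rule fun_space.independent_family_spans[OF finI finite_monoms2 card])
    show "q i \<in> fun_space.span (monoms2 (d - 2))" if "i \<in> I" for i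
      using that poly2_degree_le_Q_fun[of _ d]
      by (auto simp: I_def q_def simp flip: poly2_degree_le_iff_span)
    show "c i = 0" if "(\<Sum>i\<in>I. (\<lambda>x. c i * q i x)) = 0" "i \<in> I" for c i
      using coeff[of "fst i" "snd i" c] that by (simp add: segment_integral_def)
    show "P \<in> fun_space.span (monoms2 (d - 2))"
      using P by (simp add: poly2_degree_le_iff_span)
  qed
  then obtain c where c: "P = (\<Sum>i\<in>I. (\<lambda>x. c i * q i x))" by blast
  have "c i = 0" if "i \<in> I" for i
    using coeff[where c = c, folded c, of "fst i" "snd i"] zero[of "snd i" "fst i"] that
    by (auto simp: I_def)
  then show ?thesis by (simp add: c sum_fun_apply)
qed

lemma convex_cv: "convex (cv d a)"
  by (simp add: cv_def)

lemma point_in_cv: "m < d \<Longrightarrow> a m \<in> cv d a"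
  by (simp add: cv_def hull_inc)

lemma hakopian_interpolant_formula:
  assumes gp: "general_position d a" and f: "continuous_on (cv d a) f"
  shows "hakopian_interpolant d a f
    (\<lambda>x. \<Sum>t<d. \<Sum>s<t. Q_fun d a s t x * segment_integral (a s) (a t) f)"
    (is "hakopian_interpolant d a f ?P")
  unfolding hakopian_interpolant_def
proof (intro conjI allI impI)
  define I where "I = (SIGMA t:{..<d}. {..<t})"
  define q where "q = (\<lambda>(t, s). Q_fun d a s t)"
  define c where "c = (\<lambda>(t, s). segment_integral (a s) (a t) f)"
  have finI: "finite I" by (simp add: I_def)
  have P: "?P = (\<lambda>x. \<Sum>i\<in>I. c i * q i x)"
    by (rule ext) (simp add: I_def q_def c_def sum.Sigma split_def mult.commute)
  have deg: "poly2_degree_le (d - 2) (q i)" if "i \<in> I" for i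
    using that poly2_degree_le_Q_fun[of _ d] by (auto simp: I_def q_def)
  show *: "poly2_degree_le (d - 2) ?P"
    unfolding P by (intro poly2_degree_le_sum poly2_degree_le_cmult deg)
  fix u v assume uv: "u < v \<and> v < d"
  have "segment_integral (a u) (a v) ?P = (\<Sum>i\<in>I. c i * segment_integral (a u) (a v) (q i))"
    unfolding P by (rule segment_integral_sum_cmult[OF finI continuous_on_poly2[OF deg]])
  also have "\<dots> = (\<Sum>i\<in>I. if i = (v, u) then c i else 0)"
    using uv by (intro sum.cong refl) (auto simp: I_def q_def segment_integral_Q_fun[OF gp] split: if_splits)
  also have "\<dots> = segment_integral (a u) (a v) f" using uv finI by (simp add: I_def c_def)
  finally show "segment_integral (a u) (a v) (\<lambda>x. f x - ?P x) = 0"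
    using uv segment_integral_diff[OF f continuous_on_poly2[OF *] convex_cv, of "a u" "a v"]
    by (simp add: point_in_cv)
qed

lemma hakopian_interpolant_unique:
  assumes d: "d \<ge> 2" and gp: "general_position d a" and f: "continuous_on (cv d a) f"
    and P: "hakopian_interpolant d a f P" and R: "hakopian_interpolant d a f R"
  shows "P = R"
proof
  fix x
  have deg: "poly2_degree_le (d - 2) P" "poly2_degree_le (d - 2) R"
    using P R by (auto simp: hakopian_interpolant_def)
  have "P x - R x = 0"
  proof (rule poly2_zero_if_segment_integrals_zero[OF d gp, where P = "\<lambda>x. P x - R x"])
    show "poly2_degree_le (d - 2) (\<lambda>x. P x - R x)" using deg by (rule poly2_degree_le_diff)
    fix u v assume uv: "u < v" "v < d"
    then have in_cv: "a u \<in> cv d a" "a v \<in> cv d a" by (auto simp: point_in_cv)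
    note diff = segment_integral_diff[OF _ _ convex_cv in_cv]
    note cont = continuous_on_poly2[OF deg(1)] continuous_on_poly2[OF deg(2)]
    show "segment_integral (a u) (a v) (\<lambda>x. P x - R x) = 0"
      using P R uv diff[OF f cont(1)] diff[OF f cont(2)] diff[OF cont]
      by (simp add: hakopian_interpolant_def)
  qed
  then show "P x = R x" by simp
qed

lemma hakopian_eq:
  assumes "d \<ge> 2" "general_position d a" "continuous_on (cv d a) f"
  shows "hakopian d a f = (\<lambda>x. \<Sum>t<d. \<Sum>s<t. Q_fun d a s t x * segment_integral (a s) (a t) f)"
  unfolding hakopian_def
  using hakopian_interpolant_formula[OF assms(2,3)] hakopian_interpolant_unique[OF assms]
  by (intro the_equality) blast+

section \<open>Continuity of the operator\<close>

lemma mspace_C_space: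
  "mspace (C_space S) = {f \<in> extensional S. continuous_on S f \<and> bounded (f ` S)}"
  by auto

lemma continuous_map_hakopian:
  assumes d: "d \<ge> 2" and gp: "general_position d a" and K: "compact K"
  shows "continuous_map (mtopology_of (C_space (cv d a))) (mtopology_of (C_space K))
          (\<lambda>f. restrict (hakopian d a f) K)"
proof (rule Lipschitz_continuous_imp_continuous_map)
  let ?I = "segment_integral"
  have contQ: "continuous_on S (Q_fun d a s t)" if "s < t" "t < d" for s t S
    using continuous_on_poly2[OF poly2_degree_le_Q_fun] that by simp
  have "\<exists>M. \<forall>x\<in>K. \<bar>Q_fun d a s t x\<bar> \<le> M" if "s < t" "t < d" for s t
    using compact_imp_bounded[OF compact_continuous_image[OF contQ[OF that] K]]
    by (auto simp: bounded_iff)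
  then obtain M where M: "\<And>s t x. s < t \<Longrightarrow> t < d \<Longrightarrow> x \<in> K \<Longrightarrow> \<bar>Q_fun d a s t x\<bar> \<le> M s t"
    by metis
  \<comment> \<open>The absolute values keep the constant nonnegative when \<open>K\<close> is empty.\<close>
  define B where "B = (\<Sum>t<d. \<Sum>s<t. \<bar>M s t\<bar>)"
  have cont: "continuous_on (cv d a) f" if "f \<in> mspace (C_space (cv d a))" for f
    using that by (simp add: mspace_C_space del: mspace_cfunspace)
  show "Lipschitz_continuous_map (C_space (cv d a)) (C_space K) (\<lambda>f. restrict (hakopian d a f) K)"
    unfolding Lipschitz_continuous_map_def
  proof (intro conjI exI[of _ B] ballI funcsetI)
    fix f assume f: "f \<in> mspace (C_space (cv d a))"
    have "continuous_on K (hakopian d a f)"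
      unfolding hakopian_eq[OF d gp cont[OF f]] by (intro continuous_intros contQ) auto
    then show "restrict (hakopian d a f) K \<in> mspace (C_space K)"
      using compact_imp_bounded[OF compact_continuous_image[OF _ K]]
      by (simp add: mspace_C_space del: mspace_cfunspace cong: continuous_on_cong_simp)
  next
    fix f g assume f: "f \<in> mspace (C_space (cv d a))" and g: "g \<in> mspace (C_space (cv d a))"
    define D where "D = mdist (C_space (cv d a)) f g"
    have ne: "topspace (top_of_set (cv d a)) \<noteq> {}" using point_in_cv[of 0 d a] d by auto
    have D: "\<bar>f x - g x\<bar> \<le> D" if "x \<in> cv d a" for x
      using cfunspace_mdist_le[OF f g ne, of D] that by (simp add: D_def dist_real_def)
    have D0: "D \<ge> 0" unfolding D_def by simp
    have int: "\<bar>?I (a s) (a t) f - ?I (a s) (a t) g\<bar> \<le> D" if "s < t" "t < d" for s t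
    proof -
      have in_cv: "a s \<in> cv d a" "a t \<in> cv d a" using that by (auto simp: point_in_cv)
      show ?thesis
        unfolding segment_integral_diff[OF cont[OF f] cont[OF g] convex_cv in_cv, symmetric]
        by (rule abs_segment_integral_le[OF _ convex_cv in_cv D])
          (intro continuous_intros cont f g)
    qed
    show "mdist (C_space K) (restrict (hakopian d a f) K) (restrict (hakopian d a g) K) \<le> B * D"
    proof (rule mdist_cfunspace_le)
      show "0 \<le> B * D" using D0 by (auto simp: B_def intro!: mult_nonneg_nonneg sum_nonneg)
      fix x assume "x \<in> topspace (top_of_set K)"
      then have x: "x \<in> K" by simp
      have "\<bar>hakopian d a f x - hakopian d a g x\<bar>
          = \<bar>\<Sum>t<d. \<Sum>s<t. Q_fun d a s t x * (?I (a s) (a t) f - ?I (a s) (a t) g)\<bar>"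
        by (simp add: hakopian_eq[OF d gp] cont f g algebra_simps sum_subtractf del: mspace_cfunspace)
      also have "\<dots> \<le> (\<Sum>t<d. \<Sum>s<t. \<bar>Q_fun d a s t x * (?I (a s) (a t) f - ?I (a s) (a t) g)\<bar>)"
        by (intro order_trans[OF sum_abs] sum_mono sum_abs)
      also have "\<dots> \<le> (\<Sum>t<d. \<Sum>s<t. \<bar>M s t\<bar> * D)"
      proof (intro sum_mono)
        fix t s assume "t \<in> {..<d}" "s \<in> {..<t}"
        then show "\<bar>Q_fun d a s t x * (?I (a s) (a t) f - ?I (a s) (a t) g)\<bar> \<le> \<bar>M s t\<bar> * D"
          unfolding abs_mult using M[of s t x] x int[of s t] by (intro mult_mono) auto
      qed
      also have "\<dots> = B * D" by (simp add: B_def sum_distrib_right)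
      finally show "mdist euclidean_metric (restrict (hakopian d a f) K x)
          (restrict (hakopian d a g) K x) \<le> B * D"
        using x by (simp add: dist_real_def)
    qed
  qed
qed

theorem theorem3p3:
  fixes d :: nat and a :: "nat \<Rightarrow> real^2"
  assumes "d \<ge> 2" and "general_position d a"
  shows
    "(\<forall>s t. s < t \<and> t < d \<longrightarrow> deriv (h_fun d a s t) (perp (a s - a t) \<bullet> a s) \<noteq> 0) \<and>
     (\<forall>f. continuous_on (cv d a) f \<longrightarrow>
        (\<exists>!P. hakopian_interpolant d a f P) \<and>
        (\<forall>x. hakopian d a f x =
           (\<Sum>t<d. \<Sum>s<t. Q_fun d a s t x * segment_integral (a s) (a t) f))) \<and>
     (\<forall>K. compact K \<longrightarrow>
        continuous_map (mtopology_of (C_space (cv d a))) (mtopology_of (C_space K))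
          (\<lambda>f. restrict (hakopian d a f) K))"
proof (intro conjI allI impI)
  show "deriv (h_fun d a s t) (perp (a s - a t) \<bullet> a s) \<noteq> 0" if "s < t \<and> t < d" for s t
    using deriv_h_fun_nonzero[OF assms(2), of s t] that by simp
  show "\<exists>!P. hakopian_interpolant d a f P" if "continuous_on (cv d a) f" for f
    using hakopian_interpolant_formula[OF assms(2) that]
      hakopian_interpolant_unique[OF assms that] by blast
  show "hakopian d a f x = (\<Sum>t<d. \<Sum>s<t. Q_fun d a s t x * segment_integral (a s) (a t) f)"
    if "continuous_on (cv d a) f" for f x
    by (simp add: hakopian_eq[OF assms that])
  show "continuous_map (mtopology_of (C_space (cv d a))) (mtopology_of (C_space K))
      (\<lambda>f. restrict (hakopian d a f) K)" if "compact K" for K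
    by (rule continuous_map_hakopian[OF assms that])
qed

end
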